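(* Let $p>q>0$ be real numbers, $n\ge 0$ an integer, and $\mathbf{P}_0,\dots,\mathbf{P}_n\in\mathbb{R}^3$. The $(p,q)$-Bézier curve $\mathbf{P}(t;p,q)=\sum_{i=0}^{n}\mathbf{P}_i\,B^{i,n}_{p,q}(t)$, $t\in[0,1]$, has the following properties. (1) Geometric and affine invariance: for every affine map $A:\mathbb{R}^3\to\mathbb{R}^3$ and every $t\in[0,1]$, $A(\mathbf{P}(t;p,q))=\sum_{i=0}^{n}A(\mathbf{P}_i)\,B^{i,n}_{p,q}(t)$. (2) Convex hull property: for every $t\in[0,1]$, $\mathbf{P}(t;p,q)$ lies in the convex hull of its control polygon, i.e. of $\{\mathbf{P}_0,\dots,\mathbf{P}_n\}$. (3) End-point interpolation: $\mathbf{P}(0;p,q)=\mathbf{P}_0$ and $\mathbf{P}(1;p,q)=\mathbf{P}_n$. (4) Reducibility: when $p=1$, the curve is the $q$-Bézier curve $\sum_{i=0}^{n}\mathbf{P}_i\begin{bmatrix} n\\ i\end{bmatrix}_{q}t^{i}\prod_{s=0}^{n-i-1}(1-q^{s}t)$.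
   Context: For real $p>q>0$ and integers $n\ge 0$, the $(p,q)$-integers are $[n]_{p,q}=\frac{p^n-q^n}{p-q}$; $[n]_{p,q}!=[1]_{p,q}[2]_{p,q}\cdots[n]_{p,q}$ with $[0]_{p,q}!=1$; and for $0\le k\le n$ the $(p,q)$-binomial coefficient is $\begin{bmatrix} n\\ k\end{bmatrix}_{p,q}=\frac{[n]_{p,q}!}{[k]_{p,q}!\,[n-k]_{p,q}!}$. The $q$-binomial coefficient $\begin{bmatrix} n\\ k\end{bmatrix}_{q}$ is the usual Gaussian binomial coefficient, built in the same way from $[n]_q=\frac{1-q^n}{1-q}$. The $(p,q)$-Bernstein functions of degree $n$ are, for $0\le k\le n$ and $t\in[0,1]$, $$B^{k,n}_{p,q}(t)=\frac{1}{p^{n(n-1)/2}}\begin{bmatrix} n\\ k\end{bmatrix}_{p,q}p^{k(k-1)/2}\,t^{k}\prod_{s=0}^{n-k-1}(p^{s}-q^{s}t),$$ where an empty product equals $1$. The points $\mathbf{P}_i$ are called control points; the control polygon is obtained by joining consecutive control points. *)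

theory Defs
  imports "HOL-Analysis.Analysis"
begin

definition pq_int :: "real \<Rightarrow> real \<Rightarrow> nat \<Rightarrow> real" where
  "pq_int p q n = (p ^ n - q ^ n) / (p - q)"

definition pq_fact :: "real \<Rightarrow> real \<Rightarrow> nat \<Rightarrow> real" where
  "pq_fact p q n = (\<Prod>j = 1..n. pq_int p q j)"

(* Only meaningful for k <= n, since n - k is truncated subtraction. *)
definition pq_binomial :: "real \<Rightarrow> real \<Rightarrow> nat \<Rightarrow> nat \<Rightarrow> real" where
  "pq_binomial p q n k = pq_fact p q n / (pq_fact p q k * pq_fact p q (n - k))"

definition q_int :: "real \<Rightarrow> nat \<Rightarrow> real" where
  "q_int q n = (1 - q ^ n) / (1 - q)"

definition q_fact :: "real \<Rightarrow> nat \<Rightarrow> real" where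
  "q_fact q n = (\<Prod>j = 1..n. q_int q j)"

definition q_binomial :: "real \<Rightarrow> nat \<Rightarrow> nat \<Rightarrow> real" where
  "q_binomial q n k = q_fact q n / (q_fact q k * q_fact q (n - k))"

(* The exponents m (m - 1) / 2 are integers, also for m = 0 with truncated
   subtraction, so div is exact.  The index s < n - k is s = 0, ..., n - k - 1. *)
definition pq_bernstein :: "real \<Rightarrow> real \<Rightarrow> nat \<Rightarrow> nat \<Rightarrow> real \<Rightarrow> real" where
  "pq_bernstein p q n k t =
     1 / p ^ (n * (n - 1) div 2) * pq_binomial p q n k * p ^ (k * (k - 1) div 2) * t ^ k
       * (\<Prod>s<n - k. p ^ s - q ^ s * t)"

(* The control points are P 0, ..., P n; values of P beyond n play no role. *)
definition pq_bezier ::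
  "real \<Rightarrow> real \<Rightarrow> nat \<Rightarrow> (nat \<Rightarrow> 'a::real_vector) \<Rightarrow> real \<Rightarrow> 'a" where
  "pq_bezier p q n P t = (\<Sum>i\<le>n. pq_bernstein p q n i t *\<^sub>R P i)"

definition q_bezier :: "real \<Rightarrow> nat \<Rightarrow> (nat \<Rightarrow> 'a::real_vector) \<Rightarrow> real \<Rightarrow> 'a" where
  "q_bezier q n P t =
     (\<Sum>i\<le>n. (q_binomial q n i * t ^ i * (\<Prod>s<n - i. 1 - q ^ s * t)) *\<^sub>R P i)"

definition affine_map :: "('a::real_vector \<Rightarrow> 'b::real_vector) \<Rightarrow> bool" where
  "affine_map A \<longleftrightarrow> (\<exists>L b. linear L \<and> (\<forall>x. A x = L x + b))"

end

theory Submission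
  imports Defs
begin

text \<open>
  Everything rests on the \<open>(p,q)\<close>-Bernstein functions being nonnegative and summing to 1.
  The sum is computed by induction on the degree: the Pascal rule
  \<open>C(n+1,j) = q^(n+1-j) C(n,j-1) + p^j C(n,j)\<close> splits the sum of degree \<open>n+1\<close> in two, and after
  expanding the last factor \<open>p^(n-j) - q^(n-j) t\<close> of the product in the second part, its \<open>q\<close>-terms
  cancel the first part, leaving \<open>p^n\<close> times the sum of degree \<open>n\<close>.
  At an end point only one of the Bernstein functions is nonzero, so it equals 1.
\<close>

lemma pq_fact_0 [simp]: "pq_fact p q 0 = 1"
  by (simp add: pq_fact_def)

lemma pq_fact_Suc: "pq_fact p q (Suc n) = pq_int p q (Suc n) * pq_fact p q n"
  by (simp add: pq_fact_def mult.commute)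

lemma pq_int_pos:
  assumes "0 < q" "q < p" "0 < n"
  shows "0 < pq_int p q n"
  using assms by (simp add: pq_int_def power_strict_mono)

lemma pq_fact_pos:
  assumes "0 < q" "q < p"
  shows "0 < pq_fact p q n"
  unfolding pq_fact_def using assms by (intro prod_pos) (auto intro: pq_int_pos)

lemma pq_binomial_pos:
  assumes "0 < q" "q < p"
  shows "0 < pq_binomial p q n k"
  unfolding pq_binomial_def using pq_fact_pos[OF assms] by simp

text \<open>Insert \<open>p ^ k * q ^ m\<close> with both signs into the numerator
  \<open>p ^ (m + k) - q ^ (m + k)\<close>.\<close>

lemma pq_int_add: "pq_int p q (m + k) = q ^ m * pq_int p q k + p ^ k * pq_int p q m"
  by (simp add: pq_int_def power_add algebra_simps flip: add_divide_distrib)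

lemma pq_binomial_0:
  assumes "0 < q" "q < p"
  shows "pq_binomial p q n 0 = 1"
  using pq_fact_pos[OF assms, of n] by (simp add: pq_binomial_def)

lemma pq_binomial_self:
  assumes "0 < q" "q < p"
  shows "pq_binomial p q n n = 1"
  using pq_fact_pos[OF assms, of n] by (simp add: pq_binomial_def)

text \<open>Apply \<open>pq_int_add\<close> to the top factor of the numerator with Suc n = (n - k)
  + (k + 1): in each summand the remaining (p,q)-integer cancels the last factor of one of the two
  factorials in the denominator.\<close>

lemma pq_binomial_Suc_Suc:
  assumes "0 < q" "q < p" "k < n"
  shows "pq_binomial p q (Suc n) (Suc k) =
    q ^ (n - k) * pq_binomial p q n k + p ^ Suc k * pq_binomial p q n (Suc k)"
proof -
  obtain m where n: "n = k + Suc m"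
    using \<open>k < n\<close> less_imp_Suc_add by auto
  have split: "pq_int p q (Suc n) = q ^ Suc m * pq_int p q (Suc k) + p ^ Suc k * pq_int p q (Suc m)"
    using pq_int_add[of p q "Suc m" "Suc k"] by (simp add: n add_ac)
  have pos: "pq_fact p q k > 0" "pq_fact p q m > 0" "pq_int p q (Suc k) > 0" "pq_int p q (Suc m) > 0"
    using assms by (auto intro: pq_fact_pos pq_int_pos)
  have diffs: "Suc n - Suc k = Suc m" "n - k = Suc m" "n - Suc k = m"
    by (auto simp: n)
  show ?thesis
    unfolding pq_binomial_def diffs pq_fact_Suc[of p q n] pq_fact_Suc[of p q k] pq_fact_Suc[of p q m] split
    using pos by (simp add: divide_simps) (simp add: algebra_simps)
qed

\<comment> \<open>The case distinctions keep out the junk values \<open>pq_binomial p q n k\<close> for \<open>k > n\<close>, which are nonzero.\<close>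
lemma pq_binomial_Suc:
  assumes "0 < q" "q < p" "j \<le> Suc n"
  shows "pq_binomial p q (Suc n) j =
    (if j = 0 then 0 else q ^ (Suc n - j) * pq_binomial p q n (j - 1)) +
    (if j \<le> n then p ^ j * pq_binomial p q n j else 0)"
proof (cases j)
  case 0
  then show ?thesis using assms by (simp add: pq_binomial_0)
next
  case (Suc k)
  then show ?thesis
    using assms pq_binomial_Suc_Suc[of q p k n]
    by (cases "k = n") (auto simp: pq_binomial_self)
qed

lemma triangular_Suc: "Suc n * (Suc n - 1) div 2 = n * (n - 1) div 2 + n"
  by (cases n) (auto simp: algebra_simps)

text \<open>The normalising power of p is moved to the right-hand side, so that the induction step
  is multiplication by \<open>p ^ n\<close>.\<close>

lemma sum_pq_bernstein_scaled:
  fixes p q t :: real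
  assumes "0 < q" "q < p"
  shows "(\<Sum>k\<le>n. pq_binomial p q n k * p ^ (k * (k - 1) div 2) * t ^ k * (\<Prod>s<n - k. p ^ s - q ^ s * t))
    = p ^ (n * (n - 1) div 2)"
proof (induction n)
  case 0
  then show ?case using assms by (simp add: pq_binomial_0)
next
  case (Suc n)
  \<comment> \<open>\<open>T\<close> depends on the index alone and \<open>R\<close> on the codegree
    alone, so passing to degree \<open>Suc n\<close> alters only the binomial and the argument of
    \<open>R\<close>.\<close>
  define T where "T k = p ^ (k * (k - 1) div 2) * t ^ k" for k
  define R where "R m = (\<Prod>s<m. p ^ s - q ^ s * t)" for m
  define C where "C = pq_binomial p q n"
  have T_Suc: "T (Suc k) = p ^ k * t * T k" for k
    unfolding T_def triangular_Suc by (simp add: power_add)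
  have "(\<Sum>j\<le>Suc n. pq_binomial p q (Suc n) j * p ^ (j * (j - 1) div 2) * t ^ j * (\<Prod>s<Suc n - j. p ^ s - q ^ s * t))
      = (\<Sum>j\<le>Suc n. (if j = 0 then 0 else q ^ (Suc n - j) * C (j - 1) * T j * R (Suc n - j))
                  + (if j \<le> n then p ^ j * C j * T j * R (Suc n - j) else 0))"
    using assms by (intro sum.cong refl) (auto simp: pq_binomial_Suc C_def T_def R_def algebra_simps)
  \<comment> \<open>The first part loses its zero term at j = 0 and is reindexed by j = Suc k; the
    second loses its zero term at j = Suc n.\<close>
  also have "\<dots> = (\<Sum>k\<le>n. q ^ (n - k) * C k * T (Suc k) * R (n - k))
                + (\<Sum>k\<le>n. p ^ k * C k * T k * R (Suc n - k))"
    by (simp add: sum.distrib sum.atMost_Suc_shift[of "\<lambda>j. if j = 0 then 0 else _ j"] del: sum.atMost_Suc)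
       (simp add: sum.atMost_Suc)
  also have "\<dots> = (\<Sum>k\<le>n. p ^ n * (C k * T k * R (n - k)))"
    unfolding sum.distrib[symmetric]
  proof (intro sum.cong refl)
    fix k assume "k \<in> {..n}"
    \<comment> \<open>Since k \<le> n, \<open>Suc n - k\<close> is \<open>Suc (n - k)\<close>, so
      the product gains exactly the factor with s = n - k.\<close>
    then have pn: "p ^ n = p ^ k * p ^ (n - k)" and R: "R (Suc n - k) = R (n - k) * (p ^ (n - k) - q ^ (n - k) * t)"
      by (auto simp: R_def Suc_diff_le simp flip: power_add)
    show "q ^ (n - k) * C k * T (Suc k) * R (n - k) + p ^ k * C k * T k * R (Suc n - k)
        = p ^ n * (C k * T k * R (n - k))"
      unfolding T_Suc R pn by (simp add: algebra_simps)
  qed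
  also have "\<dots> = p ^ n * p ^ (n * (n - 1) div 2)"
    using Suc by (simp add: C_def T_def R_def mult_ac flip: sum_distrib_left)
  also have "\<dots> = p ^ (Suc n * (Suc n - 1) div 2)"
    by (simp only: triangular_Suc power_add mult.commute)
  finally show ?case .
qed

lemma sum_pq_bernstein:
  assumes "0 < q" "q < p"
  shows "(\<Sum>k\<le>n. pq_bernstein p q n k t) = 1"
proof -
  have "(\<Sum>k\<le>n. pq_bernstein p q n k t) = 1 / p ^ (n * (n - 1) div 2) * p ^ (n * (n - 1) div 2)"
    unfolding pq_bernstein_def sum_pq_bernstein_scaled[OF assms, of n t, symmetric] sum_distrib_left
    by (simp add: mult.assoc)
  then show ?thesis using assms by simp
qed

lemma pq_bernstein_nonneg:
  assumes "0 < q" "q < p" "t \<in> {0..1}"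
  shows "0 \<le> pq_bernstein p q n k t"
proof -
  \<comment> \<open>From t \<le> 1 and q < p every factor of the product is nonnegative; for k > n
    the product is empty.\<close>
  have "q ^ s * t \<le> p ^ s" for s
    using mult_mono[of "q ^ s" "p ^ s" t 1] power_mono[of q p s] assms by simp
  then have "0 \<le> (\<Prod>s<n - k. p ^ s - q ^ s * t)"
    by (intro prod_nonneg) simp
  moreover have "0 \<le> pq_binomial p q n k"
    using pq_binomial_pos[OF assms(1,2)] by (rule less_imp_le)
  ultimately show ?thesis
    using assms by (auto simp: pq_bernstein_def)
qed

text \<open>The linear part commutes with the sum, and the translation \<open>b\<close> is
  reproduced because the weights sum to 1.\<close>

lemma pq_bezier_affine:
  assumes "0 < q" "q < p" "affine_map A"
  shows "A (pq_bezier p q n P t) = pq_bezier p q n (A \<circ> P) t"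
proof -
  obtain L b where L: "linear L" and A: "\<And>x. A x = L x + b"
    using assms by (auto simp: affine_map_def)
  show ?thesis
    by (simp add: pq_bezier_def A linear_sum[OF L] linear_scale[OF L] scaleR_add_right sum.distrib
        sum_pq_bernstein[OF assms(1,2)] flip: scaleR_sum_left)
qed

lemma pq_bezier_in_convex_hull:
  assumes "0 < q" "q < p" "t \<in> {0..1}"
  shows "pq_bezier p q n P t \<in> convex hull (P ` {..n})"
  unfolding pq_bezier_def using assms
  by (intro convex_sum) (auto simp: sum_pq_bernstein pq_bernstein_nonneg hull_inc)

lemma pq_bezier_eq_point:
  assumes "0 < q" "q < p" "i \<le> n"
    and zero: "\<And>k. k \<le> n \<Longrightarrow> k \<noteq> i \<Longrightarrow> pq_bernstein p q n k t = 0"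
  shows "pq_bezier p q n P t = P i"
proof -
  \<comment> \<open>Replacing each control point by \<open>P i\<close> only changes terms of weight
    zero. Now \<open>P i\<close> factors out of the sum, so its own weight need not be
    evaluated.\<close>
  have "pq_bezier p q n P t = (\<Sum>k\<le>n. pq_bernstein p q n k t *\<^sub>R P i)"
    unfolding pq_bezier_def using zero by (intro sum.cong) auto
  then show ?thesis
    using assms by (simp add: sum_pq_bernstein flip: scaleR_sum_left)
qed

text \<open>The power \<open>t ^ k\<close> vanishes for k > 0.\<close>

lemma pq_bezier_at_0:
  assumes "0 < q" "q < p"
  shows "pq_bezier p q n P 0 = P 0"
  using assms by (intro pq_bezier_eq_point) (auto simp: pq_bernstein_def)

text \<open>For k < n the product contains the factor with s = 0, which is 1 - t and vanishes here;
  this is the witness 0.\<close>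

lemma pq_bezier_at_1:
  assumes "0 < q" "q < p"
  shows "pq_bezier p q n P 1 = P n"
  using assms by (intro pq_bezier_eq_point) (auto simp: pq_bernstein_def intro!: bexI[of _ 0])

lemma pq_bezier_1: "pq_bezier 1 q n P t = q_bezier q n P t"
proof -
  \<comment> \<open>With p = 1 both sides unfold to the same expression, so they agree as functions,
    including the values at k > n.\<close>
  have "pq_binomial 1 q = q_binomial q"
    by (intro ext) (simp add: pq_binomial_def q_binomial_def pq_fact_def q_fact_def pq_int_def q_int_def)
  then show ?thesis
    by (simp add: pq_bezier_def q_bezier_def pq_bernstein_def)
qed

theorem theorem4p1:
  fixes p q :: real and n :: nat and P :: "nat \<Rightarrow> real ^ 3"
  assumes "q > 0" and "p > q"
  shows "(\<forall>A :: real ^ 3 \<Rightarrow> real ^ 3. affine_map A \<longrightarrow>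
            (\<forall>t\<in>{0..1}. A (pq_bezier p q n P t) = (\<Sum>i\<le>n. pq_bernstein p q n i t *\<^sub>R A (P i))))
       \<and> (\<forall>t\<in>{0..1}. pq_bezier p q n P t \<in> convex hull (P ` {..n}))
       \<and> (pq_bezier p q n P 0 = P 0 \<and> pq_bezier p q n P 1 = P n)
       \<and> (p = 1 \<longrightarrow> (\<forall>t\<in>{0..1}. pq_bezier p q n P t = q_bezier q n P t))"
proof (intro conjI allI impI ballI)
  fix A :: "real ^ 3 \<Rightarrow> real ^ 3" and t :: real
  assume "affine_map A"
  then show "A (pq_bezier p q n P t) = (\<Sum>i\<le>n. pq_bernstein p q n i t *\<^sub>R A (P i))"
    using pq_bezier_affine[OF assms] by (simp add: pq_bezier_def)
qed (use assms in \<open>auto simp: pq_bezier_in_convex_hull pq_bezier_at_0 pq_bezier_at_1 pq_bezier_1\<close>)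

end
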